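(* Let $m\in\mathbb{N}_0$ and let $\kappa\in\mathbb{R}$ with $|\kappa|>0$. Define $c_0=1$ and \[ c_j=\prod_{k=0}^{j-1}\frac{2(m-k)-1}{\kappa},\qquad j>0 . \] Then \[ I_1(m,m,\kappa,t)=-\frac{1}{\kappa}\sum_{j=1}^{m}c_{m-j}\,t^{j}J_{j-1,\kappa}(t)+c_m\,I_1(0,0,\kappa,t). \]
   Context: $\mathbb{N}_0=\{0,1,2,\dots\}$. $J_m$ is the Bessel function of the first kind of integer order $m$, and $J_{m,\kappa}(t):=J_m(\kappa t)$ for real $t$. $I_1(n,m,\kappa,t):=\int t^nJ_m(\kappa t)\,dt$ denotes the indefinite integral (an antiderivative in $t$ of $t^nJ_m(\kappa t)$); identities between indefinite integrals are understood up to an additive constant. Empty sums are $0$. *)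

theory Defs
  imports "HOL-Analysis.Analysis"
begin

text \<open>Bessel function of the first kind of nonnegative integer order, at a real argument,
  by its everywhere convergent power series.\<close>

definition bessel_J :: "nat \<Rightarrow> real \<Rightarrow> real" where
  "bessel_J m x = (\<Sum>k. (-1) ^ k / (fact k * fact (k + m)) * (x / 2) ^ (2 * k + m))"

text \<open>The indefinite integral of \<open>t ^ n * J\<^sub>m (\<kappa> t)\<close> is a function only up to an additive
  constant, so it is rendered as a predicate: \<open>F\<close> is one of the antiderivatives on the real line.\<close>

definition is_I1 :: "nat \<Rightarrow> nat \<Rightarrow> real \<Rightarrow> (real \<Rightarrow> real) \<Rightarrow> bool" where
  "is_I1 n m \<kappa> F \<longleftrightarrow>
     (\<forall>t. (F has_real_derivative t ^ n * bessel_J m (\<kappa> * t)) (at t))"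

text \<open>The coefficients depend on \<open>m\<close> and \<open>\<kappa>\<close>; \<open>c\<^sub>0 = 1\<close> is the empty product.
  The subtraction is performed in the reals.\<close>

definition c_coeff :: "nat \<Rightarrow> real \<Rightarrow> nat \<Rightarrow> real" where
  "c_coeff m \<kappa> j = (\<Prod>k<j. (2 * (real m - real k) - 1) / \<kappa>)"

text \<open>The series converges, so \<open>suminf\<close> has its intended value, and antiderivatives exist,
  so statements quantified over \<^const>\<open>is_I1\<close> are not vacuous.\<close>

lemma summable_bessel_coeff:
  "summable (\<lambda>k. 1 / (fact k * fact (k + m)) * y ^ k :: real)"
proof (rule summable_comparison_test')
  show "summable (\<lambda>k. inverse (fact k) * \<bar>y\<bar> ^ k)"
    using summable_exp[of "\<bar>y\<bar>"] by simp
  fix k :: nat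
  have "(fact k :: real) \<le> fact k * fact (k + m)"
    using mult_left_mono[OF fact_ge_1[of "k + m"], of "fact k :: real"] by simp
  hence "1 / (fact k * fact (k + m)) \<le> inverse (fact k :: real)"
    by (simp add: field_simps)
  thus "norm (1 / (fact k * fact (k + m)) * y ^ k) \<le> inverse (fact k) * \<bar>y\<bar> ^ k"
    using mult_right_mono[of "1 / (fact k * fact (k + m))" "inverse (fact k)" "\<bar>y\<bar> ^ k"]
    by (simp add: abs_mult power_abs)
qed

lemma bessel_J_term:
  fixes x :: real
  shows "(-1) ^ k / (fact k * fact (k + m)) * (x / 2) ^ (2 * k + m) =
    (x / 2) ^ m * (1 / (fact k * fact (k + m)) * (- ((x / 2) ^ 2)) ^ k)"
proof -
  have "(- ((x / 2) ^ 2)) ^ k = (-1) ^ k * (x / 2) ^ (2 * k)"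
    by (subst power_minus) (simp only: power_mult)
  thus ?thesis by (simp only: power_add mult_ac times_divide_eq_left times_divide_eq_right mult_1_left mult_1_right)
qed

lemma bessel_J_sums:
  "(\<lambda>k. (-1) ^ k / (fact k * fact (k + m)) * (x / 2) ^ (2 * k + m)) sums bessel_J m x"
  unfolding bessel_J_def bessel_J_term
  by (rule summable_sums[OF summable_mult[OF summable_bessel_coeff]])

lemma continuous_bessel_J: "isCont (bessel_J m) x"
proof -
  define P :: "real \<Rightarrow> real" where "P = (\<lambda>y. \<Sum>k. 1 / (fact k * fact (k + m)) * y ^ k)"
  have eq: "bessel_J m = (\<lambda>x. (x / 2) ^ m * P (- ((x / 2) ^ 2)))"
    unfolding bessel_J_def bessel_J_term P_def
    by (rule ext, rule suminf_mult[OF summable_bessel_coeff])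
  have "isCont P y" for y
    unfolding P_def by (rule isCont_powser_converges_everywhere[OF summable_bessel_coeff])
  hence "isCont (\<lambda>x. P (- ((x / 2) ^ 2))) x"
    by (intro isCont_o2[where f = "\<lambda>x. - ((x / 2) ^ 2)" and g = P] continuous_intros) auto
  thus ?thesis unfolding eq by (intro continuous_mult continuous_intros) auto
qed

lemma is_I1_exists: "\<exists>F. is_I1 n m \<kappa> F"
proof -
  have "isCont (\<lambda>t. t ^ n * bessel_J m (\<kappa> * t)) t" for t
    by (intro continuous_mult continuous_intros
        isCont_o2[where f = "\<lambda>t. \<kappa> * t" and g = "bessel_J m"] continuous_bessel_J)
  hence "\<exists>F. \<forall>t. -\<infinity> < ereal t \<longrightarrow> ereal t < \<infinity> \<longrightarrow>
      (F has_vector_derivative t ^ n * bessel_J m (\<kappa> * t)) (at t)"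
    by (intro einterval_antiderivative) auto
  thus ?thesis
    by (simp add: is_I1_def has_real_derivative_iff_has_vector_derivative)
qed

end

theory Submission imports Defs begin

text \<open>
  Everything rests on the identity
  \[ \frac{d}{dt}\, t^{n+1} J_n(\kappa t)
       = (2n+1)\, t^n J_n(\kappa t) - \kappa\, t^{n+1} J_{n+1}(\kappa t), \]
  which is \<open>bessel_J_power_derivative\<close>.  Solved for its last term, it expresses the integrand of
  \<open>I\<^sub>1(n+1, n+1)\<close> as \<open>(2n+1)/\<kappa>\<close> times the integrand of \<open>I\<^sub>1(n, n)\<close> plus an exact derivative.
  Going down from \<open>m\<close> to \<open>0\<close>, the factors \<open>(2n+1)/\<kappa>\<close> accumulate to the coefficients \<open>c\<^sub>j\<close> and the
  exact derivatives to the sum over \<open>j\<close>; what remains is \<open>c\<^sub>m J\<^sub>0(\<kappa> t)\<close>, the integrand of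
  \<open>c\<^sub>m I\<^sub>1(0, 0)\<close>.  This is \<open>bessel_sum_derivative\<close>, and the theorem follows because two functions
  on the line with equal derivatives differ by a constant.

  The identity itself comes from writing \<open>J\<^sub>n(x) = (x/2)\<^sup>n P\<^sub>n(-x\<^sup>2/4)\<close> with
  \<open>P\<^sub>n(y) = \<Sum>\<^sub>k y\<^sup>k / (k! (k+n)!)\<close>, since termwise differentiation gives \<open>P\<^sub>n' = P\<^sub>n\<^sub>+\<^sub>1\<close>.
\<close>

text \<open>This is the hypergeometric function \<open>\<^sub>0F\<^sub>1(n + 1; y) / n!\<close>, the normalisation in which
  \<open>d/dy\<close> is exactly the shift of \<open>n\<close> by one.\<close>

definition bessel_entire :: "nat \<Rightarrow> real \<Rightarrow> real" where
  "bessel_entire n y = (\<Sum>k. 1 / (fact k * fact (k + n)) * y ^ k)"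

lemma bessel_J_eq_bessel_entire:
  "bessel_J n x = (x / 2) ^ n * bessel_entire n (- ((x / 2) ^ 2))"
  unfolding bessel_J_def bessel_J_term bessel_entire_def
  by (rule suminf_mult[OF summable_bessel_coeff])

text \<open>Differentiation cancels the factor \<open>k + 1\<close> of \<open>(k + 1)!\<close> in the shifted coefficient
  \<open>1 / ((k + 1)! (k + 1 + n)!)\<close>, and what is left is the coefficient for \<open>n + 1\<close>.\<close>

lemma bessel_entire_derivative:
  "(bessel_entire n has_real_derivative bessel_entire (Suc n) y) (at y)"
proof -
  have "diffs (\<lambda>k. 1 / (fact k * fact (k + n)) :: real) = (\<lambda>k. 1 / (fact k * fact (k + Suc n)))"
    by (simp add: diffs_def fun_eq_iff del: of_nat_Suc)
  thus ?thesis
    using termdiffs_strong_converges_everywhere[OF summable_bessel_coeff, of n y]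
    by (simp add: bessel_entire_def[abs_def])
qed

text \<open>Multiplying \<open>J\<^sub>n(\<kappa> t)\<close> by \<open>t\<^sup>n\<^sup>+\<^sup>1\<close> turns the power in front of the even entire factor into
  \<open>t\<^sup>2\<^sup>n\<^sup>+\<^sup>1\<close>, which accounts for the factor \<open>2n + 1\<close>.  In this form the computation also covers
  \<open>t = 0\<close> and \<open>n = 0\<close>, without the quotient \<open>n J\<^sub>n(x) / x\<close> in the usual formula for \<open>J\<^sub>n'(x)\<close>.\<close>

lemma bessel_J_power_derivative:
  "((\<lambda>t. t ^ Suc n * bessel_J n (\<kappa> * t)) has_real_derivative
     (2 * real n + 1) * (t ^ n * bessel_J n (\<kappa> * t))
       - \<kappa> * (t ^ Suc n * bessel_J (Suc n) (\<kappa> * t))) (at t)"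
proof -
  define A where "A = (\<lambda>t. - ((\<kappa> * t / 2) ^ 2))"
  have powers: "t ^ n * (\<kappa> * t / 2) ^ n = (\<kappa> / 2) ^ n * t ^ (2 * n)" for t
    by (simp add: mult_2 power_add power_divide power_mult_distrib)
  have form: "t ^ Suc n * bessel_J n (\<kappa> * t) =
      (\<kappa> / 2) ^ n * (t ^ Suc (2 * n) * bessel_entire n (A t))" for t
  proof -
    have "t ^ Suc n * bessel_J n (\<kappa> * t) =
        t * (t ^ n * (\<kappa> * t / 2) ^ n) * bessel_entire n (A t)"
      by (simp only: bessel_J_eq_bessel_entire A_def power_Suc mult_ac)
    thus ?thesis by (simp only: powers power_Suc mult_ac)
  qed
  have "(A has_real_derivative - (\<kappa> ^ 2 * t / 2)) (at t)"
    unfolding A_def by (auto intro!: derivative_eq_intros simp: power2_eq_square)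
  note inner = DERIV_chain2[OF bessel_entire_derivative this]
  have outer: "((\<lambda>t. t ^ Suc (2 * n)) has_real_derivative (2 * real n + 1) * t ^ (2 * n)) (at t)"
    using DERIV_pow[of "Suc (2 * n)" t] by (simp add: add.commute)
  have first: "(2 * real n + 1) * (t ^ n * bessel_J n (\<kappa> * t)) =
      (\<kappa> / 2) ^ n * ((2 * real n + 1) * t ^ (2 * n) * bessel_entire n (A t))"
  proof -
    have "t ^ n * bessel_J n (\<kappa> * t) = t ^ n * (\<kappa> * t / 2) ^ n * bessel_entire n (A t)"
      by (simp only: bessel_J_eq_bessel_entire A_def mult_ac)
    thus ?thesis by (simp only: powers mult_ac)
  qed
  have second: "\<kappa> * (t ^ Suc n * bessel_J (Suc n) (\<kappa> * t)) =
      (\<kappa> / 2) ^ n * (bessel_entire (Suc n) (A t) * (\<kappa> ^ 2 * t / 2) * t ^ Suc (2 * n))"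
  proof -
    have "\<kappa> * (t ^ Suc n * bessel_J (Suc n) (\<kappa> * t)) =
        (t ^ n * (\<kappa> * t / 2) ^ n) * (\<kappa> * t * (\<kappa> * t / 2) * bessel_entire (Suc n) (A t))"
      by (simp only: bessel_J_eq_bessel_entire A_def power_Suc mult_ac)
    also have "\<dots> = (\<kappa> / 2) ^ n *
        (bessel_entire (Suc n) (A t) * (\<kappa> ^ 2 * t / 2) * t ^ Suc (2 * n))"
      unfolding powers by (simp add: power2_eq_square)
    finally show ?thesis .
  qed
  from DERIV_cmult[OF DERIV_mult[OF outer inner], of "(\<kappa> / 2) ^ n"] show ?thesis
    unfolding form first second by (rule DERIV_cong) (simp add: algebra_simps)
qed

lemma c_coeff_0 [simp]: "c_coeff m \<kappa> 0 = 1"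
  by (simp add: c_coeff_def)

text \<open>Raising \<open>m\<close> by one prepends a factor to the product and shifts all the others, since its
  factors depend only on \<open>m - k\<close>.\<close>

lemma c_coeff_Suc_Suc:
  "c_coeff (Suc m) \<kappa> (Suc j) = (2 * real m + 1) / \<kappa> * c_coeff m \<kappa> j"
  unfolding c_coeff_def by (subst prod.lessThan_Suc_shift) (simp add: algebra_simps)

text \<open>The sum for \<open>m + 1\<close> is \<open>(2m + 1)/\<kappa>\<close> times the sum for \<open>m\<close> plus the new top term
  \<open>t\<^sup>m\<^sup>+\<^sup>1 J\<^sub>m(\<kappa> t)\<close>.  In its derivative the two multiples of \<open>t\<^sup>m J\<^sub>m(\<kappa> t)\<close> cancel, so that the
  sum telescopes.\<close>

lemma bessel_sum_derivative:
  assumes "\<kappa> \<noteq> 0"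
  shows "((\<lambda>t. \<Sum>j = 1..m. c_coeff m \<kappa> (m - j) * t ^ j * bessel_J (j - 1) (\<kappa> * t))
    has_real_derivative
      \<kappa> * (c_coeff m \<kappa> m * bessel_J 0 (\<kappa> * t) - t ^ m * bessel_J m (\<kappa> * t))) (at t)"
proof (induction m)
  case 0
  show ?case by simp
next
  case (Suc m)
  let ?S = "\<lambda>m t. \<Sum>j = 1..m. c_coeff m \<kappa> (m - j) * t ^ j * bessel_J (j - 1) (\<kappa> * t)"
  have step: "?S (Suc m) t = (2 * real m + 1) / \<kappa> * ?S m t + t ^ Suc m * bessel_J m (\<kappa> * t)" for t
  proof -
    have "(\<Sum>j = 1..m. c_coeff (Suc m) \<kappa> (Suc m - j) * t ^ j * bessel_J (j - 1) (\<kappa> * t)) =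
        (2 * real m + 1) / \<kappa> * ?S m t"
      unfolding sum_distrib_left
      by (rule sum.cong) (simp_all add: Suc_diff_le c_coeff_Suc_Suc mult.assoc)
    thus ?thesis by simp
  qed
  have "((\<lambda>t. (2 * real m + 1) / \<kappa> * ?S m t + t ^ Suc m * bessel_J m (\<kappa> * t)) has_real_derivative
      (2 * real m + 1) / \<kappa> *
        (\<kappa> * (c_coeff m \<kappa> m * bessel_J 0 (\<kappa> * t) - t ^ m * bessel_J m (\<kappa> * t))) +
      ((2 * real m + 1) * (t ^ m * bessel_J m (\<kappa> * t))
        - \<kappa> * (t ^ Suc m * bessel_J (Suc m) (\<kappa> * t)))) (at t)"
    by (rule DERIV_add[OF DERIV_cmult[OF Suc.IH] bessel_J_power_derivative])
  thus ?case
    unfolding step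
    by (rule DERIV_cong) (use assms in \<open>simp add: c_coeff_Suc_Suc field_simps\<close>)
qed

theorem proposition2p6:
  fixes m :: nat and \<kappa> :: real and F G :: "real \<Rightarrow> real"
  assumes "\<bar>\<kappa>\<bar> > 0"
    and "is_I1 m m \<kappa> F"
    and "is_I1 0 0 \<kappa> G"
  shows "\<exists>C. \<forall>t. F t =
    - (1 / \<kappa>) * (\<Sum>j = 1..m. c_coeff m \<kappa> (m - j) * t ^ j * bessel_J (j - 1) (\<kappa> * t))
      + c_coeff m \<kappa> m * G t + C"
proof -
  define R where "R = (\<lambda>t. - (1 / \<kappa>) *
    (\<Sum>j = 1..m. c_coeff m \<kappa> (m - j) * t ^ j * bessel_J (j - 1) (\<kappa> * t)) + c_coeff m \<kappa> m * G t)"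
  have \<kappa>: "\<kappa> \<noteq> 0" using assms(1) by simp
  have G: "(G has_real_derivative bessel_J 0 (\<kappa> * t)) (at t)" for t
    using assms(3) by (simp add: is_I1_def)
  have F: "(F has_real_derivative t ^ m * bessel_J m (\<kappa> * t)) (at t)" for t
    using assms(2) by (simp add: is_I1_def)
  have R: "(R has_real_derivative t ^ m * bessel_J m (\<kappa> * t)) (at t)" for t
    unfolding R_def
    by (rule DERIV_cong[OF DERIV_add[OF
          DERIV_cmult[OF bessel_sum_derivative[OF \<kappa>]] DERIV_cmult[OF G]]])
      (use \<kappa> in \<open>simp add: field_simps\<close>)
  have "((\<lambda>t. F t - R t) has_real_derivative 0) (at t)" for t
    using DERIV_diff[OF F R, of t] by simp
  hence const: "F t - R t = F 0 - R 0" for t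
    using DERIV_isconst_all[of "\<lambda>t. F t - R t" t 0] by blast
  have "F t = R t + (F 0 - R 0)" for t
    using const[of t] by linarith
  thus ?thesis unfolding R_def by blast
qed

end
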